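(* Let $A$ be a linear order with both a left endpoint and a right endpoint. Then $A^{\omega}$ has a parity-reversing automorphism.
   Context: $A^\omega$: infinite sequences of elements of $A$, ordered lexicographically; $au$ denotes prepending $a\in A$ to $u$. $u\sim_2 v$ iff there exist finite sequences $r,s$ with $|r|\equiv|s|\pmod 2$ and $u'\in A^\omega$ with $u=ru'$, $v=su'$. A parity-reversing automorphism of $A^\omega$ is an order automorphism $f$ of $A^\omega$ with $f(u)\sim_2 au$ for all $u\in A^\omega$, $a\in A$. *)

theory Defs
  imports Main "HOL-Library.Stream" "HOL-Library.Fun_Lexorder"
begin

definition lex_less :: "'a::linorder stream \<Rightarrow> 'a stream \<Rightarrow> bool"
  where "lex_less u v \<longleftrightarrow> less_fun (snth u) (snth v)"

definition tail_equiv2 :: "'a stream \<Rightarrow> 'a stream \<Rightarrow> bool"  (infix "\<sim>\<^sub>2" 50)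
  where "u \<sim>\<^sub>2 v \<longleftrightarrow>
    (\<exists>r s u'. length r mod 2 = length s mod 2 \<and> u = r @- u' \<and> v = s @- u')"

definition order_automorphism :: "('a::linorder stream \<Rightarrow> 'a stream) \<Rightarrow> bool"
  where "order_automorphism f \<longleftrightarrow>
    bij f \<and> (\<forall>u v. lex_less u v \<longleftrightarrow> lex_less (f u) (f v))"

definition parity_reversing_automorphism :: "('a::linorder stream \<Rightarrow> 'a stream) \<Rightarrow> bool"
  where "parity_reversing_automorphism f \<longleftrightarrow>
    order_automorphism f \<and> (\<forall>u a. f u \<sim>\<^sub>2 a ## u)"

end

theory Submission
  imports Defs
begin

text \<open>
  Let \<open>l\<close> and \<open>r\<close> be the endpoints and \<open>w = r l r l \<dots>\<close>. Prepending \<open>l\<close> maps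
  \<open>{u. u \<le> w}\<close> onto \<open>{v. v \<le> l w}\<close>, and since \<open>w = r l w\<close>, deleting the (necessarily equal
  to \<open>r\<close>) first letter maps \<open>{u. u > w}\<close> onto \<open>{v. v > l w}\<close>. Gluing the two maps yields the
  automorphism, and each of them reverses parity because it adds or removes exactly one letter.
  The point \<open>w\<close> is what Lindenbaum's Schroeder--Bernstein argument produces from the embeddings
  \<open>u \<mapsto> l u\<close> onto an initial and \<open>u \<mapsto> r u\<close> onto a final segment.
\<close>

lemma lex_less_SCons_iff:
  "lex_less (a ## u) (b ## v) \<longleftrightarrow> a < b \<or> a = b \<and> lex_less u v"
proof
  assume "lex_less (a ## u) (b ## v)"
  then obtain k where k: "(a ## u) !! k < (b ## v) !! k"
    and eq: "\<And>k'. k' < k \<Longrightarrow> (a ## u) !! k' = (b ## v) !! k'"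
    by (auto simp: lex_less_def less_fun_def)
  show "a < b \<or> a = b \<and> lex_less u v"
  proof (cases k)
    case 0
    with k show ?thesis by simp
  next
    case (Suc n)
    have "u !! i = v !! i" if "i < n" for i
      using eq[of "Suc i"] that Suc by simp
    with Suc k eq[of 0] show ?thesis
      by (auto simp: lex_less_def less_fun_def)
  qed
next
  assume "a < b \<or> a = b \<and> lex_less u v"
  then show "lex_less (a ## u) (b ## v)"
  proof
    assume "a < b"
    then show ?thesis
      by (auto simp: lex_less_def less_fun_def intro!: exI[of _ 0])
  next
    assume *: "a = b \<and> lex_less u v"
    then obtain k where "u !! k < v !! k" "\<And>k'. k' < k \<Longrightarrow> u !! k' = v !! k'"
      by (auto simp: lex_less_def less_fun_def)
    with * show ?thesis
      by (auto simp: lex_less_def less_fun_def less_Suc_eq_0_disj intro!: exI[of _ "Suc k"])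
  qed
qed

lemma lex_less_irrefl: "\<not> lex_less u u"
  by (simp add: lex_less_def less_fun_def)

lemma lex_less_trans: "lex_less u v \<Longrightarrow> lex_less v w \<Longrightarrow> lex_less u w"
  unfolding lex_less_def by (rule less_fun_trans)

lemma lex_less_linear: "lex_less u v \<or> u = v \<or> lex_less v u"
proof (cases "\<exists>k. u !! k \<noteq> v !! k")
  case True
  define k where "k = (LEAST k. u !! k \<noteq> v !! k)"
  have "u !! k \<noteq> v !! k"
    using True unfolding k_def by (rule LeastI_ex)
  moreover have "u !! i = v !! i" if "i < k" for i
    using not_less_Least that unfolding k_def by blast
  ultimately show ?thesis
    unfolding lex_less_def less_fun_def by (metis linorder_neqE)
next
  case False
  then have "snth u = snth v"
    by auto
  then show ?thesis
    \<comment> \<open>\<open>stream_smap_nats\<close> recovers a stream from its function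
      \<open>snth\<close>.\<close>
    by (metis stream_smap_nats)
qed

text \<open>As \<open>lex_less\<close> is total, strict monotonicity already forces injectivity and
  reflection of the order.\<close>

lemma order_automorphismI:
  assumes mono: "\<And>u v. lex_less u v \<Longrightarrow> lex_less (f u) (f v)"
    and "surj f"
  shows "order_automorphism f"
proof -
  have "inj f"
    by (rule injI) (metis lex_less_irrefl lex_less_linear mono)
  moreover have "lex_less u v" if "lex_less (f u) (f v)" for u v
    using that by (metis lex_less_irrefl lex_less_linear lex_less_trans mono)
  ultimately show ?thesis
    unfolding order_automorphism_def bij_def using assms by blast
qed

theorem theorem4p3:
  assumes "\<exists>l :: 'a::linorder. \<forall>x. l \<le> x"
    and "\<exists>r :: 'a. \<forall>x. x \<le> r"
  shows "\<exists>f :: 'a stream \<Rightarrow> 'a stream. parity_reversing_automorphism f"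
proof -
  obtain l r :: 'a where l: "\<And>x. l \<le> x" and r: "\<And>x. x \<le> r"
    using assms by blast
  define w where "w = cycle [r, l]"
  have w: "w = r ## l ## w"
    unfolding w_def by (subst cycle_decomp) simp_all
  \<comment> \<open>The branches agree at \<open>w\<close>, since
    \<open>stl w = l ## w\<close>.\<close>
  define f where "f u = (if lex_less w u then stl u else l ## u)" for u
  \<comment> \<open>\<open>w\<close> starts with the maximum \<open>r\<close>, so everything above
    \<open>w\<close> does too.\<close>
  have above: "\<exists>v. u = r ## v \<and> lex_less (l ## w) v" if "lex_less w u" for u
  proof (cases u)
    case (SCons a v)
    with that have "lex_less (r ## l ## w) (a ## v)"
      by (simp flip: w)
    with SCons r[of a] show ?thesis
      by (auto simp: lex_less_SCons_iff)
  qed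
  have mono: "lex_less (f u) (f v)" if uv: "lex_less u v" for u v
  proof (cases "lex_less w v")
    case False
    with uv have "\<not> lex_less w u"
      using lex_less_trans by blast
    with False uv show ?thesis
      by (simp add: f_def lex_less_SCons_iff)
  next
    case True
    then obtain v' where v': "v = r ## v'" "lex_less (l ## w) v'"
      using above by blast
    show ?thesis
    proof (cases "lex_less w u")
      case wu: True
      then obtain u' where "u = r ## u'"
        using above by blast
      with True wu v' uv show ?thesis
        by (simp add: f_def lex_less_SCons_iff)
    next
      case False
      \<comment> \<open>Here u \<le> w < v, and \<open>l ## w\<close> separates the two
        images.\<close>
      then have "l ## u = l ## w \<or> lex_less (l ## u) (l ## w)"
        using lex_less_linear[of u w] by (auto simp: lex_less_SCons_iff)
      with v' have "lex_less (l ## u) v'"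
        using lex_less_trans by metis
      with True False v' show ?thesis
        by (simp add: f_def)
    qed
  qed
  have "\<exists>u. f u = v" for v
  proof (cases "lex_less (l ## w) v")
    case True
    then have "lex_less w (r ## v)"
      by (subst w) (simp add: lex_less_SCons_iff)
    then have "f (r ## v) = v"
      by (simp add: f_def)
    then show ?thesis ..
  next
    case False
    obtain a u where v: "v = a ## u"
      by (cases v)
    \<comment> \<open>As \<open>l\<close> is least, v \<le> \<open>l ## w\<close> forces
      \<open>v\<close> to start with \<open>l\<close>.\<close>
    with False l[of a] have "a = l" "\<not> lex_less w u"
      by (auto simp: lex_less_SCons_iff)
    with v have "f u = v"
      by (simp add: f_def)
    then show ?thesis ..
  qed
  then have "surj f"
    unfolding surj_def by metis
  with mono have "order_automorphism f"
    by (rule order_automorphismI)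
  moreover have "f u \<sim>\<^sub>2 a ## u" for u a
  proof (cases "lex_less w u")
    case True
    then obtain v where "u = r ## v"
      using above by blast
    with True show ?thesis
      unfolding tail_equiv2_def f_def
      \<comment> \<open>Here \<open>f u = v\<close> and \<open>a ## u = a ## r ## v\<close>: the
        prefixes have lengths 0 and 2.\<close>
      by (intro exI[of _ "[]"] exI[of _ "[a, r]"] exI[of _ v]) simp
  next
    case False
    then show ?thesis
      unfolding tail_equiv2_def f_def
      by (intro exI[of _ "[l]"] exI[of _ "[a]"] exI[of _ u]) simp
  qed
  ultimately show ?thesis
    unfolding parity_reversing_automorphism_def by blast
qed

end
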